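(* For every shallow sequent $\Gamma$ and ordinals $\alpha,\gamma$: if $\mathsf{G_C}\vdash^{\alpha}_{\gamma}\Gamma$ then $\mathsf{D_C}\vdash^{\omega\cdot\alpha}_{\gamma}\Gamma$.
   Context: Fix $h\ge1$ agents. Formulas: $A::=p\mid\bar p\mid A\vee A\mid A\wedge A\mid\Diamond_iA\mid\Box_iA\mid\widetilde{\mathsf C}A\mid\mathsf CA$ ($1\le i\le h$), $\widetilde{\mathsf C}$ the De Morgan dual of $\mathsf C$; $\bar A$ by De Morgan laws. $\Box A:=\Box_1A\wedge\dots\wedge\Box_hA$, $\Diamond A:=\Diamond_1A\vee\dots\vee\Diamond_hA$, $\Box^k,\Diamond^k$ iterations. Rank: $rk(p)=rk(\bar p)=0$, $rk(A\wedge B)=rk(A\vee B)=\max(rk A,rk B)+1$, $rk(\Box_iA)=rk(\Diamond_iA)=rk(A)+1$, $rk(\mathsf CA)=rk(\widetilde{\mathsf C}A)=\omega+rk(A)$. A shallow sequent is a finite multiset of formulas; for a shallow sequent $\Gamma$, $\Diamond_i\Gamma$ and $\widetilde{\mathsf C}\Gamma$ prefix the connective to every element. System $\mathsf{G_C}$ (premises / conclusion): axiom $\Gamma,p,\bar p$; $\wedge$: $\Gamma,A$ and $\Gamma,B$ / $\Gamma,A\wedge B$; $\vee$: $\Gamma,A,B/\Gamma,A\vee B$; $\Box_i$: $\Gamma,\widetilde{\mathsf C}\Delta,A\,/\,\Diamond_i\Gamma,\widetilde{\mathsf C}\Delta,\Box_iA,\Sigma$; $\mathsf C$: premises $\Gamma,\Box^kA$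 for all $k\ge1$ / $\Gamma,\mathsf CA$; $\widetilde{\mathsf C}$: $\Gamma,\widetilde{\mathsf C}A,\Diamond A/\Gamma,\widetilde{\mathsf C}A$. Its cut: $\Gamma,A$ and $\Delta,\bar A$ / $\Gamma,\Delta$, of rank $rk(A)$. Nested sequents are finite multisets of formulas and boxed sequents $[\Delta]_i$ (so shallow sequents are nested sequents); contexts $\Gamma\{\ \}$ as usual. System $\mathsf{D_C}$: axiom $\Gamma\{p,\bar p\}$; $\wedge$: $\Gamma\{A\},\Gamma\{B\}/\Gamma\{A\wedge B\}$; $\vee$: $\Gamma\{A,B\}/\Gamma\{A\vee B\}$; $\Box_i$: $\Gamma\{[A]_i\}/\Gamma\{\Box_iA\}$; $\Diamond_i$: $\Gamma\{\Diamond_iA,[\Delta,A]_i\}/\Gamma\{\Diamond_iA,[\Delta]_i\}$; $\mathsf C$: premises $\Gamma\{\Box^kA\}$, all $k\ge1$ / $\Gamma\{\mathsf CA\}$; $\widetilde{\mathsf C}$: $\Gamma\{\widetilde{\mathsf C}A,\Diamond^kA\}/\Gamma\{\widetilde{\mathsf C}A\}$ (some $k\ge1$); its cut: $\Gamma\{A\},\Gamma\{\bar A\}/\Gamma\{\emptyset\}$, rank $rk(A)$. Proofs: well-founded, possibly infinitely branching trees with axiom leaves; depth = least ordinal greater than the depths of immediate subproofs. $\mathcal S\vdash^\alpha_\gamma\Gamma$: there is a proof of $\Gamma$ in $\mathcal S$ plus that system's cuts of rank $<\gamma$, of depth $\le\alpha$. *)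

theory Defs
  imports Main "HOL-Library.Multiset"
begin

unbundle cardinal_syntax

section \<open>Ordinals\<close>

text \<open>
  An element of \<open>'a ordinal\<close> is an isomorphism class of well-orders whose fields are subsets of
  \<open>'a + nat\<close>. The summand \<open>nat\<close> makes the carrier infinite, so that \<open>'a ordinal\<close> consists of all
  ordinals of cardinality at most \<open>max \<bar>'a\<bar> \<aleph>\<^sub>0\<close>. It therefore contains all countable ordinals, is
  closed under ordinal sum and product, and every countable set of its elements is strictly
  bounded. Since \<open>'a\<close> is an arbitrary type, a statement about \<open>'a ordinal\<close> covers ordinals of
  every size.
\<close>

quotient_type 'a ordinal = "('a + nat) rel" / partial: "\<lambda>r s. r =o s"
proof (rule part_equivpI)
  show "\<exists>r :: ('a + nat) rel. r =o r"
    by (rule exI[of _ "{}"]) (simp add: ordIso_reflexive)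
  show "symp (\<lambda>r s :: ('a + nat) rel. r =o s)"
    by (rule sympI, rule ordIso_symmetric)
  show "transp (\<lambda>r s :: ('a + nat) rel. r =o s)"
    by (rule transpI, rule ordIso_transitive)
qed

instantiation ordinal :: (type) wellorder
begin

lift_definition less_eq_ordinal :: "'a ordinal \<Rightarrow> 'a ordinal \<Rightarrow> bool" is "\<lambda>r s. r \<le>o s"
proof (rule iffI)
  fix r r' s s' :: "('a + nat) rel"
  assume *: "r =o r'" "s =o s'"
  show "r' \<le>o s'" if "r \<le>o s"
    by (rule ordIso_ordLeq_trans[OF ordIso_symmetric[OF *(1)] ordLeq_ordIso_trans[OF that *(2)]])
  show "r \<le>o s" if "r' \<le>o s'"
    by (rule ordIso_ordLeq_trans[OF *(1) ordLeq_ordIso_trans[OF that ordIso_symmetric[OF *(2)]]])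
qed

lift_definition less_ordinal :: "'a ordinal \<Rightarrow> 'a ordinal \<Rightarrow> bool" is "\<lambda>r s. r <o s"
proof (rule iffI)
  fix r r' s s' :: "('a + nat) rel"
  assume *: "r =o r'" "s =o s'"
  show "r' <o s'" if "r <o s"
    by (rule ordIso_ordLess_trans[OF ordIso_symmetric[OF *(1)] ordLess_ordIso_trans[OF that *(2)]])
  show "r <o s" if "r' <o s'"
    by (rule ordIso_ordLess_trans[OF *(1) ordLess_ordIso_trans[OF that ordIso_symmetric[OF *(2)]]])
qed

instance
proof
  fix x y z :: "'a ordinal"
  have wo: "Well_order (rep_ordinal u)" for u :: "'a ordinal"
    using Quotient3_rep_reflp[OF Quotient3_ordinal] unfolding ordIso_def by blast
  show "(x < y) = (x \<le> y \<and> \<not> y \<le> x)"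
    unfolding less_ordinal.rep_eq less_eq_ordinal.rep_eq
    using not_ordLess_ordLeq ordLess_imp_ordLeq ordLess_or_ordLeq[OF wo wo] by blast
  show "x \<le> x"
    unfolding less_eq_ordinal.rep_eq by (rule ordLeq_reflexive[OF wo])
  show "x \<le> z" if "x \<le> y" "y \<le> z"
    using that unfolding less_eq_ordinal.rep_eq by (rule ordLeq_transitive)
  show "x = y" if "x \<le> y" "y \<le> x"
    using that by transfer (rule iffD2[OF ordIso_iff_ordLeq conjI])
  show "x \<le> y \<or> y \<le> x"
    unfolding less_eq_ordinal.rep_eq by (rule ordLeq_total[OF wo wo])
next
  fix P :: "'a ordinal \<Rightarrow> bool" and a
  assume step: "\<And>x. (\<And>y. y < x \<Longrightarrow> P y) \<Longrightarrow> P x"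
  have "wfp ((<) :: 'a ordinal \<Rightarrow> _)"
  proof (rule wfp_if_convertible_to_wfp)
    show "wfp (\<lambda>r s :: ('a + nat) rel. r <o s)"
      using wf_ordLess by (simp add: wfp_def)
    show "rep_ordinal x <o rep_ordinal y" if "x < y" for x y :: "'a ordinal"
      using that by (simp add: less_ordinal.rep_eq)
  qed
  then show "P a"
    by (rule wfp_induct_rule) (rule step)
qed

end

text \<open>
  The order type of a well-order \<open>s\<close> on an arbitrary type, meaningful if \<open>s\<close> has a copy on
  \<open>'a + nat\<close>, see \<open>rep_otype\<close> below.
\<close>

definition otype :: "'b rel \<Rightarrow> 'a ordinal"
  where "otype s = abs_ordinal (SOME r. r =o s)"

lemma rep_otype:
  fixes s :: "'b rel"
  assumes "Well_order s" "|Field s| \<le>o |UNIV :: ('a + nat) set|"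
  shows "rep_ordinal (otype s :: 'a ordinal) =o s"
proof -
  obtain f :: "'b \<Rightarrow> 'a + nat" where "inj_on f (Field s)"
    using iffD2[OF card_of_ordLeq assms(2)] by blast
  then have "dir_image s f =o s"
    by (rule ordIso_symmetric[OF dir_image_ordIso[OF assms(1)]])
  then have some: "(SOME r :: ('a + nat) rel. r =o s) =o s"
    by (rule someI)
  have "rep_ordinal (otype s :: 'a ordinal) =o (SOME r :: ('a + nat) rel. r =o s)"
    unfolding otype_def
    by (rule Quotient3_rep_abs[OF Quotient3_ordinal])
      (rule ordIso_transitive[OF some ordIso_symmetric[OF some]])
  then show ?thesis
    using some by (rule ordIso_transitive)
qed

definition omega :: "'a ordinal" (\<open>\<omega>\<close>)
  where "\<omega> = otype natLeq"

text \<open>\<open>osum r s\<close> places \<open>s\<close> after \<open>r\<close>.\<close>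

definition osum :: "'b rel \<Rightarrow> 'c rel \<Rightarrow> ('b + 'c) rel"
  where "osum r s =
    {(Inl x, Inl y) | x y. (x, y) \<in> r} \<union> {(Inr x, Inr y) | x y. (x, y) \<in> s} \<union>
    {(Inl x, Inr y) | x y. x \<in> Field r \<and> y \<in> Field s}"

text \<open>\<open>oprod r s\<close> replaces every point of \<open>s\<close> by a copy of \<open>r\<close>: the second component is the more
  significant one.\<close>

definition oprod :: "'b rel \<Rightarrow> 'c rel \<Rightarrow> ('b \<times> 'c) rel"
  where "oprod r s =
    {((x, y), (x', y')). x \<in> Field r \<and> x' \<in> Field r \<and> y \<in> Field s \<and> y' \<in> Field s \<and>
       (y \<noteq> y' \<and> (y, y') \<in> s \<or> y = y' \<and> (x, x') \<in> r)}"

instantiation ordinal :: (type) "{zero, one, plus, times}"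
begin

definition zero_ordinal :: "'a ordinal"
  where "0 = otype ({} :: unit rel)"

definition one_ordinal :: "'a ordinal"
  where "1 = otype {((), ())}"

definition plus_ordinal :: "'a ordinal \<Rightarrow> 'a ordinal \<Rightarrow> 'a ordinal"
  where "\<alpha> + \<beta> = otype (osum (rep_ordinal \<alpha>) (rep_ordinal \<beta>))"

definition times_ordinal :: "'a ordinal \<Rightarrow> 'a ordinal \<Rightarrow> 'a ordinal"
  where "\<alpha> * \<beta> = otype (oprod (rep_ordinal \<alpha>) (rep_ordinal \<beta>))"

instance ..

end


section \<open>Formulas\<close>

text \<open>
  Agents are the elements of a finite linearly ordered (and, like every type, nonempty) type
  \<open>'i\<close>, where \<open>h\<close> is \<open>CARD('i)\<close>; the order fixes the order of the conjuncts of \<open>\<box>A\<close> and the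
  disjuncts of \<open>\<diamond>A\<close>.
\<close>

datatype ('i, 'p) fm =
    Pos 'p
  | Neg 'p
  | Or "('i, 'p) fm" "('i, 'p) fm"
  | And "('i, 'p) fm" "('i, 'p) fm"
  | Dia 'i "('i, 'p) fm"
  | Box 'i "('i, 'p) fm"
  | CDual "('i, 'p) fm"
  | C "('i, 'p) fm"

primrec neg :: "('i, 'p) fm \<Rightarrow> ('i, 'p) fm" where
  "neg (Pos p) = Neg p"
| "neg (Neg p) = Pos p"
| "neg (Or A B) = And (neg A) (neg B)"
| "neg (And A B) = Or (neg A) (neg B)"
| "neg (Dia i A) = Box i (neg A)"
| "neg (Box i A) = Dia i (neg A)"
| "neg (CDual A) = C (neg A)"
| "neg (C A) = CDual (neg A)"

definition agents :: "'i::{finite, linorder} list"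
  where "agents = sorted_list_of_set UNIV"

text \<open>Iterated conjunctions and disjunctions associate to the right:
  \<open>\<box>\<^sub>1A \<and> (\<box>\<^sub>2A \<and> (\<dots> \<and> \<box>\<^sub>hA))\<close>.\<close>

definition EBox :: "('i::{finite, linorder}, 'p) fm \<Rightarrow> ('i, 'p) fm"
  where "EBox A = foldr (\<lambda>i. And (Box i A)) (butlast agents) (Box (last agents) A)"

definition EDia :: "('i::{finite, linorder}, 'p) fm \<Rightarrow> ('i, 'p) fm"
  where "EDia A = foldr (\<lambda>i. Or (Dia i A)) (butlast agents) (Dia (last agents) A)"

primrec rk :: "('i, 'p) fm \<Rightarrow> 'a ordinal" where
  "rk (Pos p) = 0"
| "rk (Neg p) = 0"
| "rk (Or A B) = max (rk A) (rk B) + 1"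
| "rk (And A B) = max (rk A) (rk B) + 1"
| "rk (Dia i A) = rk A + 1"
| "rk (Box i A) = rk A + 1"
| "rk (CDual A) = \<omega> + rk A"
| "rk (C A) = \<omega> + rk A"


section \<open>Proofs\<close>

text \<open>
  A set of rules over sequents of type \<open>'s\<close> is a relation between families of premises and
  conclusions. The family is a partial function on \<open>nat\<close>: empty for axioms, defined on
  \<open>{0}\<close> or \<open>{0, 1}\<close> for finitary rules, and on \<open>{1..}\<close> for the rule for \<open>C\<close>. Proofs are trees
  branching accordingly; elements of the datatype are automatically well-founded.
\<close>

type_synonym 's rules = "(nat \<rightharpoonup> 's) \<Rightarrow> 's \<Rightarrow> bool"

datatype 's tree = Node (concl: 's) (subtrees: "nat \<Rightarrow> 's tree option")

inductive is_proof :: "'s rules \<Rightarrow> 's tree \<Rightarrow> bool" for R where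
  "R (map_option concl \<circ> ts) s \<Longrightarrow> (\<And>t. t \<in> ran ts \<Longrightarrow> is_proof R t) \<Longrightarrow> is_proof R (Node s ts)"

text \<open>The depths of the immediate subproofs form a countable set, so the least strict upper bound
  exists.\<close>

primrec depth :: "'s tree \<Rightarrow> 'a ordinal" where
  "depth (Node s ts) = (LEAST \<alpha>. \<forall>\<beta> \<in> ran (map_option depth \<circ> ts). \<beta> < \<alpha>)"

definition derives :: "'s rules \<Rightarrow> 'a ordinal \<Rightarrow> 's \<Rightarrow> bool"
  where "derives R \<alpha> s \<longleftrightarrow> (\<exists>t. is_proof R t \<and> concl t = s \<and> depth t \<le> \<alpha>)"


section \<open>The shallow system\<close>

type_synonym ('i, 'p) shallow = "('i, 'p) fm multiset"

inductive GC_rule :: "('i::{finite, linorder}, 'p) shallow rules" where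
  GC_ax: "GC_rule Map.empty (\<Gamma> + {#Pos p, Neg p#})"
| GC_and: "GC_rule [0 \<mapsto> \<Gamma> + {#A#}, 1 \<mapsto> \<Gamma> + {#B#}] (\<Gamma> + {#And A B#})"
| GC_or: "GC_rule [0 \<mapsto> \<Gamma> + {#A, B#}] (\<Gamma> + {#Or A B#})"
| GC_box: "GC_rule [0 \<mapsto> \<Gamma> + image_mset CDual \<Delta> + {#A#}]
    (image_mset (Dia i) \<Gamma> + image_mset CDual \<Delta> + {#Box i A#} + \<Sigma>)"
| GC_C: "GC_rule (\<lambda>k. if 1 \<le> k then Some (\<Gamma> + {#(EBox ^^ k) A#}) else None) (\<Gamma> + {#C A#})"
| GC_CDual: "GC_rule [0 \<mapsto> \<Gamma> + {#CDual A, EDia A#}] (\<Gamma> + {#CDual A#})"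

inductive GC_cut :: "'a ordinal \<Rightarrow> ('i, 'p) shallow rules" for \<gamma> where
  "rk A < \<gamma> \<Longrightarrow> GC_cut \<gamma> [0 \<mapsto> \<Gamma> + {#A#}, 1 \<mapsto> \<Delta> + {#neg A#}] (\<Gamma> + \<Delta>)"

definition GC :: "'a ordinal \<Rightarrow> ('i::{finite, linorder}, 'p) shallow rules"
  where "GC \<gamma> ps s \<longleftrightarrow> GC_rule ps s \<or> GC_cut \<gamma> ps s"


section \<open>The nested system\<close>

datatype ('i, 'p) item =
    Fm "('i, 'p) fm"
  | Boxed 'i "('i, 'p) item multiset"

type_synonym ('i, 'p) nested = "('i, 'p) item multiset"

definition nested_of :: "('i, 'p) shallow \<Rightarrow> ('i, 'p) nested"
  where "nested_of \<Gamma> = image_mset Fm \<Gamma>"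

text \<open>\<open>Hole \<Gamma>\<close> is the context \<open>\<Gamma>, { }\<close>, and \<open>InBox \<Gamma> i c\<close> is \<open>\<Gamma>, [c]\<^sub>i\<close>.\<close>

datatype ('i, 'p) ctxt =
    Hole "('i, 'p) nested"
  | InBox "('i, 'p) nested" 'i "('i, 'p) ctxt"

primrec fill :: "('i, 'p) ctxt \<Rightarrow> ('i, 'p) nested \<Rightarrow> ('i, 'p) nested" where
  "fill (Hole \<Gamma>) \<Delta> = \<Gamma> + \<Delta>"
| "fill (InBox \<Gamma> i c) \<Delta> = \<Gamma> + {#Boxed i (fill c \<Delta>)#}"

inductive DC_rule :: "('i::{finite, linorder}, 'p) nested rules" where
  DC_ax: "DC_rule Map.empty (fill c {#Fm (Pos p), Fm (Neg p)#})"
| DC_and: "DC_rule [0 \<mapsto> fill c {#Fm A#}, 1 \<mapsto> fill c {#Fm B#}] (fill c {#Fm (And A B)#})"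
| DC_or: "DC_rule [0 \<mapsto> fill c {#Fm A, Fm B#}] (fill c {#Fm (Or A B)#})"
| DC_box: "DC_rule [0 \<mapsto> fill c {#Boxed i {#Fm A#}#}] (fill c {#Fm (Box i A)#})"
| DC_dia: "DC_rule [0 \<mapsto> fill c {#Fm (Dia i A), Boxed i (\<Delta> + {#Fm A#})#}]
    (fill c {#Fm (Dia i A), Boxed i \<Delta>#})"
| DC_C: "DC_rule (\<lambda>k. if 1 \<le> k then Some (fill c {#Fm ((EBox ^^ k) A)#}) else None)
    (fill c {#Fm (C A)#})"
| DC_CDual: "1 \<le> k \<Longrightarrow> DC_rule [0 \<mapsto> fill c {#Fm (CDual A), Fm ((EDia ^^ k) A)#}]
    (fill c {#Fm (CDual A)#})"

inductive DC_cut :: "'a ordinal \<Rightarrow> ('i, 'p) nested rules" for \<gamma> where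
  "rk A < \<gamma> \<Longrightarrow> DC_cut \<gamma> [0 \<mapsto> fill c {#Fm A#}, 1 \<mapsto> fill c {#Fm (neg A)#}] (fill c {#})"

definition DC :: "'a ordinal \<Rightarrow> ('i::{finite, linorder}, 'p) nested rules"
  where "DC \<gamma> ps s \<longleftrightarrow> DC_rule ps s \<or> DC_cut \<gamma> ps s"

end

theory Submission
  imports Defs
begin

text \<open>
  By induction on \<open>\<alpha>\<close>, every rule of the shallow system is simulated by finitely many nested rules,
  for which there is room because \<open>\<omega> * \<beta> < \<omega> * \<alpha>\<close> for \<open>\<beta> < \<alpha>\<close> and \<open>\<omega> * \<alpha>\<close> is a limit. The one
  obstacle is the rule for \<open>\<box>\<^sub>i\<close>, whose premise keeps formulas \<open>CDual D\<close> that in the nested system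
  stay outside the box. The induction hypothesis therefore lets such formulas be absent from the
  hole of a context as long as they occur somewhere above it. When one of them is unfolded into
  \<open>\<diamond>D\<close>, this \<open>\<diamond>D\<close> is pulled up to the level of \<open>CDual D\<close> as some \<open>\<diamond>\<^sup>mD\<close>, where \<open>m\<close> depends on the
  nesting depth.
\<close>

section \<open>Ordinals\<close>

lemma rep_Well_order: "Well_order (rep_ordinal \<alpha>)"
  using Quotient3_rep_reflp[OF Quotient3_ordinal] unfolding ordIso_def by blast

lemma infinite_carrier: "infinite (UNIV :: ('a + nat) set)"
  by (simp add: finite_Plus_UNIV_iff)

lemma eq_ordinal_iff: "\<alpha> = \<beta> \<longleftrightarrow> rep_ordinal \<alpha> =o rep_ordinal \<beta>"
  using rep_Well_order by (metis Quotient3_rel_rep[OF Quotient3_ordinal])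

lemma otype_less_iff:
  fixes s :: "'b rel" and t :: "'c rel"
  assumes "Well_order s" "|Field s| \<le>o |UNIV :: ('a + nat) set|"
    and "Well_order t" "|Field t| \<le>o |UNIV :: ('a + nat) set|"
  shows "(otype s :: 'a ordinal) < otype t \<longleftrightarrow> s <o t"
  unfolding less_ordinal.rep_eq
proof
  note st = rep_otype[OF assms(1,2)] rep_otype[OF assms(3,4)]
  show "s <o t" if "rep_ordinal (otype s :: 'a ordinal) <o rep_ordinal (otype t :: 'a ordinal)"
    by (rule ordIso_ordLess_trans[OF ordIso_symmetric[OF st(1)] ordLess_ordIso_trans[OF that st(2)]])
  show "rep_ordinal (otype s :: 'a ordinal) <o rep_ordinal (otype t :: 'a ordinal)" if "s <o t"
    by (rule ordIso_ordLess_trans[OF st(1) ordLess_ordIso_trans[OF that ordIso_symmetric[OF st(2)]]])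
qed

lemma less_obtain_underS:
  assumes "\<beta> < \<alpha>" "rep_ordinal \<alpha> =o s"
  obtains a where "a \<in> Field s" "rep_ordinal \<beta> =o Restr s (underS s a)"
proof -
  have "rep_ordinal \<beta> <o s"
    using assms by (simp add: less_ordinal.rep_eq) (rule ordLess_ordIso_trans)
  then show ?thesis
    using that ordLess_iff_ordIso_Restr[OF _ rep_Well_order, of s] assms(2)
    unfolding ordIso_def by blast
qed

text \<open>Every \<beta> below \<alpha> is represented by the segment of
  \<open>rep_ordinal \<alpha>\<close> below some point. Choosing such a point is injective, because
  isomorphic representatives denote the same ordinal.\<close>

lemma card_lessThan_ordinal: "|{..<\<alpha> :: 'a ordinal}| \<le>o |UNIV :: ('a + nat) set|"
proof -
  let ?r = "rep_ordinal \<alpha>"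
  have "\<forall>\<beta>\<in>{..<\<alpha>}. \<exists>a. rep_ordinal \<beta> =o Restr ?r (underS ?r a)"
    using less_obtain_underS ordIso_reflexive[OF rep_Well_order] by blast
  then obtain f where f: "rep_ordinal \<beta> =o Restr ?r (underS ?r (f \<beta>))" if "\<beta> < \<alpha>" for \<beta>
    unfolding bchoice_iff by auto
  have "inj_on f {..<\<alpha>}"
    using f by (auto intro!: inj_onI simp: eq_ordinal_iff)
      (metis ordIso_symmetric ordIso_transitive)
  then show ?thesis
    using card_of_ordLeq by blast
qed

section \<open>The size of the type of ordinals, and strict bounds of countable families\<close>

lemma strict_mono_wellorder_ge:
  fixes h :: "'b::wellorder \<Rightarrow> 'b"
  assumes "strict_mono h"
  shows "x \<le> h x"
proof (induction x rule: less_induct)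
  case (less x)
  then show ?case
    \<comment> \<open>If \<open>h x < x\<close>, then \<open>h (h x) < h x\<close>, against the
      induction hypothesis at \<open>h x\<close>.\<close>
    using strict_monoD[OF assms, of "h x" x] by (meson leD leI)
qed

lemma Well_order_le: "Well_order {(x, y :: 'b::wellorder). x \<le> y}"
proof -
  have "{(x, y :: 'b). x \<le> y} - Id = {(x, y). x < y}"
    by auto
  moreover have "Field {(x, y :: 'b). x \<le> y} = UNIV"
    by (auto simp: Field_def)
  ultimately show ?thesis
    unfolding order_on_defs using wf
    by (auto simp: refl_on_def trans_def antisym_def total_on_def)
qed

text \<open>Burali-Forti: were the type of ordinals no larger than the carrier of its elements, then
  its order type would be one of its elements.\<close>

lemma card_ordinal: "\<not> |UNIV :: 'a ordinal set| \<le>o |UNIV :: ('a + nat) set|"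
proof
  assume card: "|UNIV :: 'a ordinal set| \<le>o |UNIV :: ('a + nat) set|"
  define W where "W = {(x, y :: 'a ordinal). x \<le> y}"
  have W: "Well_order W" and FW: "Field W = UNIV"
    using Well_order_le by (auto simp: W_def Field_def)
  \<comment> \<open>The map sends \<open>x\<close> to the order type of the ordinals below it;
    \<open>card\<close> makes these order types meaningful. It is strictly increasing, hence nowhere
    below the identity, yet bounded by \<open>otype W\<close>: the value at \<open>otype W\<close>
    gives the contradiction.\<close>
  define h :: "'a ordinal \<Rightarrow> 'a ordinal" where "h x = otype (Restr W {..<x})" for x
  have of: "ofilter W {..<x}" for x
    using W FW by (auto simp: wo_rel.ofilter_def wo_rel_def under_def W_def)
  have wo: "Well_order (Restr W A)" for A
    by (rule Well_order_Restr[OF W])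
  have small: "|Field s| \<le>o |UNIV :: ('a + nat) set|" for s :: "'a ordinal rel"
    by (rule ordLeq_transitive[OF card_of_mono1 card]) simp
  have "strict_mono h"
  proof
    fix x y :: "'a ordinal"
    assume "x < y"
    then have "{..<x} < {..<y}"
      by auto
    then show "h x < h y"
      unfolding h_def otype_less_iff[OF wo small wo small]
      using ofilter_subset_ordLess[OF W of of] by blast
  qed
  moreover have "h x < otype W" for x
    unfolding h_def otype_less_iff[OF wo small W small]
    using ofilter_ordLess[OF W of] FW by blast
  ultimately show False
    using strict_mono_wellorder_ge by (meson leD)
qed

text \<open>If no strict bound existed, the whole type would be the union of countably many initial
  segments and a countable set, hence no larger than the carrier, against
  \<open>card_ordinal\<close>. This is what makes the \<open>LEAST\<close> in \<open>depth\<close>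
  attained.\<close>

lemma countable_strict_bound:
  fixes f :: "nat \<Rightarrow> 'a ordinal"
  shows "\<exists>\<alpha>. \<forall>n. f n < \<alpha>"
proof (rule ccontr)
  assume "\<not> ?thesis"
  then have *: "\<exists>n. \<alpha> \<le> f n" for \<alpha>
    by (meson not_less)
  have nat: "|UNIV :: nat set| \<le>o |UNIV :: ('a + nat) set|"
    using infinite_carrier infinite_iff_card_of_nat by blast
  have "|\<Union>n. {..<f n}| \<le>o |UNIV :: ('a + nat) set|"
    by (rule card_of_UNION_ordLeq_infinite[OF infinite_carrier nat])
      (use card_lessThan_ordinal in blast)
  moreover have "|range f| \<le>o |UNIV :: ('a + nat) set|"
    using card_of_image nat by (rule ordLeq_transitive)
  ultimately have "|(\<Union>n. {..<f n}) \<union> range f| \<le>o |UNIV :: ('a + nat) set|"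
    by (intro card_of_Un_ordLeq_infinite_Field[OF _ _ _ card_of_Card_order])
      (simp_all add: infinite_carrier Field_card_of)
  moreover have "(\<Union>n. {..<f n}) \<union> range f = UNIV"
  proof (intro equalityI subset_UNIV subsetI)
    fix x
    show "x \<in> (\<Union>n. {..<f n}) \<union> range f"
      using *[of x] by (auto simp: le_less)
  qed
  ultimately show False
    using card_ordinal by metis
qed

section \<open>Ordinal products and multiples of \<omega>\<close>

lemma Field_oprod:
  assumes "Refl r" "Refl s"
  shows "Field (oprod r s) = Field r \<times> Field s"
proof
  show "Field (oprod r s) \<subseteq> Field r \<times> Field s"
    unfolding Field_def[of "oprod r s"] by (auto simp: oprod_def)
  show "Field r \<times> Field s \<subseteq> Field (oprod r s)"
    using assms by (auto simp: oprod_def refl_on_def intro!: FieldI1)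
qed

lemma Well_order_oprod:
  assumes r: "Well_order r" and s: "Well_order s"
  shows "Well_order (oprod r s)"
proof -
  note rs = r[unfolded order_on_defs] s[unfolded order_on_defs]
  have F: "Field (oprod r s) = Field r \<times> Field s"
    using rs Field_oprod by blast
  have "Refl (oprod r s)"
    using rs unfolding refl_on_def F by (auto simp: oprod_def)
  moreover have "trans (oprod r s)"
    using rs unfolding trans_def antisym_def oprod_def by clarsimp metis
  moreover have "antisym (oprod r s)"
    using rs unfolding antisym_def oprod_def by clarsimp metis
  moreover have "Total (oprod r s)"
    using rs unfolding total_on_def F refl_on_def by (auto simp: oprod_def)
  moreover have "wf (oprod r s - Id)"
  proof (rule wf_subset)
    \<comment> \<open>\<open>oprod\<close> is lexicographic with the second component more
      significant, hence the swap.\<close>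
    show "wf (inv_image ((s - Id) <*lex*> (r - Id)) prod.swap)"
      using rs by auto
  qed (auto simp: oprod_def)
  ultimately show ?thesis
    by (auto simp: order_on_defs intro: FieldI1 FieldI2)
qed

text \<open>Up to isomorphism, \<open>t\<close> is the segment of \<open>s\<close> below some point
  \<open>a\<close>. So \<open>oprod r t\<close> is a copy of
  \<open>Field r \<times> underS s a\<close>, an initial segment of \<open>oprod r s\<close> that is
  proper since \<open>r\<close> is nonempty.\<close>

lemma oprod_ordLess_mono:
  assumes r: "Well_order r" "Field r \<noteq> {}" and "t <o s"
  shows "oprod r t <o oprod r s"
proof -
  have s: "Well_order s" and t: "Well_order t"
    using assms(3) by (auto simp: ordLess_def)
  then obtain a where a: "a \<in> Field s" and "t =o Restr s (underS s a)"
    using assms(3) ordLess_iff_ordIso_Restr by blast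
  then obtain f where f: "iso t (Restr s (underS s a)) f"
    unfolding ordIso_def by blast
  let ?A = "underS s a"
  note rs = r(1)[unfolded order_on_defs] s[unfolded order_on_defs] t[unfolded order_on_defs]
  have F: "Field (oprod r u) = Field r \<times> Field u" if "Well_order u" for u :: "'z rel"
    by (rule Field_oprod) (use rs that in \<open>auto simp: order_on_defs\<close>)
  have ofA: "ofilter s ?A"
    using s wo_rel.underS_ofilter by (metis wo_rel_def)
  have FA: "Field (Restr s ?A) = ?A"
    using Field_Restr_ofilter[OF s ofA] .
  have tF: "f ` Field t = ?A" "inj_on f (Field t)"
    and tf: "\<And>x y. x \<in> Field t \<Longrightarrow> y \<in> Field t \<Longrightarrow> (x, y) \<in> t \<longleftrightarrow> (f x, f y) \<in> Restr s ?A"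
    using f FA unfolding iso_iff2 bij_betw_def by auto
  have "iso (oprod r t) (oprod r (Restr s ?A)) (map_prod id f)"
    unfolding iso_iff2
  proof (intro conjI ballI)
    show "bij_betw (map_prod id f) (Field (oprod r t)) (Field (oprod r (Restr s ?A)))"
      unfolding F[OF t] F[OF Well_order_Restr[OF s]] FA
      using tF by (intro bij_betw_map_prod bij_betw_imageI) auto
    fix x y assume "x \<in> Field (oprod r t)" "y \<in> Field (oprod r t)"
    then have mem: "fst x \<in> Field r" "fst y \<in> Field r" "snd x \<in> Field t" "snd y \<in> Field t"
      unfolding F[OF t] by auto
    then have "f (snd x) \<in> ?A" "f (snd y) \<in> ?A"
      using tF(1) by auto
    then show "(x, y) \<in> oprod r t \<longleftrightarrow> (map_prod id f x, map_prod id f y) \<in> oprod r (Restr s ?A)"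
      using mem tf[OF mem(3,4)] inj_on_eq_iff[OF tF(2) mem(3,4)]
      unfolding oprod_def FA by (cases x; cases y) simp
  qed
  then have "oprod r t =o oprod r (Restr s ?A)"
    unfolding ordIso_def
    using Well_order_oprod[OF r(1) t] Well_order_oprod[OF r(1) Well_order_Restr[OF s]] by blast
  also have "oprod r (Restr s ?A) = Restr (oprod r s) (Field r \<times> ?A)"
    unfolding oprod_def FA by (auto dest: underS_Field)
  also have "Restr (oprod r s) (Field r \<times> ?A) <o oprod r s"
  proof -
    have of: "ofilter (oprod r s) (Field r \<times> ?A)"
      using ofA unfolding wo_rel.ofilter_def[OF wo_rel.intro[OF s]]
        wo_rel.ofilter_def[OF wo_rel.intro[OF Well_order_oprod[OF r(1) s]]] F[OF s]
      by (auto simp: oprod_def under_def)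
    have "Field r \<times> ?A < Field (oprod r s)"
      unfolding F[OF s] using underS_Field2[OF a] r(2) by (auto simp: psubset_eq times_eq_iff)
    then show ?thesis
      by (rule ofilter_ordLess[OF Well_order_oprod[OF r(1) s] of, THEN iffD1])
  qed
  finally show ?thesis .
qed

lemma Field_omega: "Field (rep_ordinal (\<omega> :: 'a ordinal)) \<noteq> {}"
  and omega_no_max: "a \<in> Field (rep_ordinal (\<omega> :: 'a ordinal)) \<Longrightarrow>
    \<exists>b. b \<noteq> a \<and> (a, b) \<in> rep_ordinal (\<omega> :: 'a ordinal)"
proof -
  have "|Field natLeq| \<le>o |UNIV :: ('a + nat) set|"
    using infinite_carrier infinite_iff_card_of_nat Field_natLeq by metis
  then have "rep_ordinal (\<omega> :: 'a ordinal) =o natLeq"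
    unfolding omega_def using rep_otype natLeq_Well_order by blast
  then obtain f where f: "iso (rep_ordinal (\<omega> :: 'a ordinal)) natLeq f"
    unfolding ordIso_def by blast
  let ?r = "rep_ordinal (\<omega> :: 'a ordinal)"
  have b: "bij_betw f (Field ?r) UNIV"
    and le: "\<And>x y. x \<in> Field ?r \<Longrightarrow> y \<in> Field ?r \<Longrightarrow> (x, y) \<in> ?r \<longleftrightarrow> f x \<le> f y"
    using f unfolding iso_iff2 Field_natLeq by (auto simp: natLeq_def)
  show "Field ?r \<noteq> {}"
    using b by (auto simp: bij_betw_def)
  show "\<exists>b. b \<noteq> a \<and> (a, b) \<in> ?r" if "a \<in> Field ?r" for a
  proof -
    obtain b where "b \<in> Field ?r" "f b = Suc (f a)"
      using b by (metis UNIV_I bij_betw_def imageE)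
    then show ?thesis
      using le[OF that] by (intro exI[of _ b]) auto
  qed
qed

lemma rep_times: "rep_ordinal (\<alpha> * \<beta>) =o oprod (rep_ordinal \<alpha>) (rep_ordinal \<beta>)"
proof -
  have "|Field (oprod (rep_ordinal \<alpha>) (rep_ordinal \<beta>))| \<le>o |UNIV \<times> UNIV :: (('a + nat) \<times> ('a + nat)) set|"
    by (rule card_of_mono1) simp
  also have "|UNIV \<times> UNIV :: (('a + nat) \<times> ('a + nat)) set| =o |UNIV :: ('a + nat) set|"
    by (rule card_of_Times_same_infinite[OF infinite_carrier])
  finally show ?thesis
    unfolding times_ordinal_def by (rule rep_otype[OF Well_order_oprod[OF rep_Well_order rep_Well_order]])
qed

lemma omega_times_less_mono:
  fixes \<alpha> \<beta> :: "'a ordinal"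
  assumes "\<beta> < \<alpha>"
  shows "\<omega> * \<beta> < \<omega> * \<alpha>"
  unfolding less_ordinal.rep_eq
proof (rule ordIso_ordLess_trans[OF rep_times ordLess_ordIso_trans])
  show "oprod (rep_ordinal (\<omega> :: 'a ordinal)) (rep_ordinal \<beta>) <o
    oprod (rep_ordinal (\<omega> :: 'a ordinal)) (rep_ordinal \<alpha>)"
    by (rule oprod_ordLess_mono[OF rep_Well_order Field_omega assms[unfolded less_ordinal.rep_eq]])
qed (rule ordIso_symmetric[OF rep_times])

text \<open>If \<open>x\<close> is the type of the segment below \<open>a\<close>, then the segment
  below any \<open>b\<close> beyond \<open>a\<close> has a type strictly between \<open>x\<close>
  and \<alpha>.\<close>

lemma no_greatest_imp_limit:
  fixes x :: "'a ordinal"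
  assumes "rep_ordinal \<alpha> =o s" "x < \<alpha>"
    and no_max: "\<And>a. a \<in> Field s \<Longrightarrow> \<exists>b. b \<noteq> a \<and> (a, b) \<in> s"
  shows "\<exists>y<\<alpha>. x < y"
proof -
  have s: "Well_order s"
    using assms(1) by (simp add: ordIso_def)
  interpret s: wo_rel s
    using s by (rule wo_rel.intro)
  obtain a where a: "a \<in> Field s" and x: "rep_ordinal x =o Restr s (underS s a)"
    using less_obtain_underS[OF assms(2,1)] .
  obtain b where b: "b \<noteq> a" "(a, b) \<in> s"
    using no_max a by blast
  have "underS s a < underS s b"
    using b s.TRANS s.ANTISYM a unfolding underS_def trans_def antisym_def by blast
  then have ab: "Restr s (underS s a) <o Restr s (underS s b)"
    using ofilter_subset_ordLess[OF s s.underS_ofilter s.underS_ofilter] by blast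
  have bs: "Restr s (underS s b) <o s"
    using underS_Restr_ordLess[OF s] a by blast
  have "Restr s (underS s b) <o rep_ordinal \<alpha>"
    using bs assms(1) by (meson ordIso_symmetric ordLess_ordIso_trans)
  \<comment> \<open>Since \<open>s\<close> may live on another type, \<open>y\<close> is built from
    a copy of this segment inside \<open>rep_ordinal \<alpha>\<close>.\<close>
  then obtain c where "Restr s (underS s b) =o Restr (rep_ordinal \<alpha>) (underS (rep_ordinal \<alpha>) c)"
    using ordLess_iff_ordIso_Restr[OF rep_Well_order Well_order_Restr[OF s]] by blast
  note c = ordIso_symmetric[OF this]
  define y :: "'a ordinal" where "y = abs_ordinal (Restr (rep_ordinal \<alpha>) (underS (rep_ordinal \<alpha>) c))"
  have "rep_ordinal y =o Restr (rep_ordinal \<alpha>) (underS (rep_ordinal \<alpha>) c)"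
    unfolding y_def
    by (rule Quotient3_rep_abs[OF Quotient3_ordinal ordIso_transitive[OF c ordIso_symmetric[OF c]]])
  then have y: "rep_ordinal y =o Restr s (underS s b)"
    using c by (rule ordIso_transitive)
  have "x < y"
    unfolding less_ordinal.rep_eq
    by (rule ordIso_ordLess_trans[OF x ordLess_ordIso_trans[OF ab ordIso_symmetric[OF y]]])
  moreover have "y < \<alpha>"
    unfolding less_ordinal.rep_eq
    by (rule ordIso_ordLess_trans[OF y ordLess_ordIso_trans[OF bs ordIso_symmetric[OF assms(1)]]])
  ultimately show ?thesis
    by blast
qed

text \<open>No point of the product is greatest: one can move up within its own copy of \<omega>,
  keeping the second component.\<close>

lemma omega_times_limit:
  assumes "x < \<omega> * \<alpha>"
  shows "\<exists>y<\<omega> * \<alpha>. x < y"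
proof (rule no_greatest_imp_limit[OF rep_times assms])
  fix a :: "('a + nat) \<times> ('a + nat)"
  let ?r = "rep_ordinal (\<omega> :: 'a ordinal)" and ?s = "rep_ordinal \<alpha>"
  have F: "Field (oprod ?r ?s) = Field ?r \<times> Field ?s"
    using rep_Well_order by (intro Field_oprod) (auto simp: order_on_defs)
  have "refl_on (Field ?s) ?s"
    using rep_Well_order by (auto simp: order_on_defs)
  moreover assume a: "a \<in> Field (oprod ?r ?s)"
  moreover obtain b where "b \<noteq> fst a" "(fst a, b) \<in> ?r"
    using a omega_no_max[of "fst a"] unfolding F by auto
  ultimately have "(a, (b, snd a)) \<in> oprod ?r ?s" "(b, snd a) \<noteq> a"
    unfolding F by (auto simp: oprod_def refl_on_def intro: FieldI2)
  then show "\<exists>b. b \<noteq> a \<and> (a, b) \<in> oprod ?r ?s"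
    by blast
qed


section \<open>Derivability\<close>

lemma depth_less:
  fixes ts :: "nat \<Rightarrow> 's tree option"
  assumes "ts k = Some t"
  shows "(depth t :: 'a ordinal) < depth (Node s ts)"
proof -
  \<comment> \<open>The default 0 only makes \<open>f\<close> total; bounding it as well does no
    harm.\<close>
  define f where "f n = (case ts n of Some t \<Rightarrow> depth t | None \<Rightarrow> (0 :: 'a ordinal))" for n
  obtain \<alpha> where "\<And>n. f n < \<alpha>"
    using countable_strict_bound[of f] by blast
  then have "\<forall>\<beta> \<in> ran (map_option depth \<circ> ts). \<beta> < \<alpha>"
    by (auto simp: ran_def f_def split: option.splits) (metis option.simps(5))
  then have "\<forall>\<beta> \<in> ran (map_option depth \<circ> ts). \<beta> < (depth (Node s ts) :: 'a ordinal)"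
    unfolding depth.simps by (rule LeastI)
  moreover have "depth t \<in> ran (map_option (depth :: 's tree \<Rightarrow> 'a ordinal) \<circ> ts)"
    using assms by (auto intro: ranI[of _ k])
  ultimately show ?thesis
    by blast
qed

text \<open>From here on trees can be forgotten: derivability is unfolded one rule at a time, and
  induction on ordinals replaces induction on proofs. The converse direction chooses one tree for
  each premise.\<close>

lemma derives_iff:
  "derives R (\<alpha> :: 'a ordinal) s \<longleftrightarrow> (\<exists>ps. R ps s \<and> (\<forall>p\<in>ran ps. \<exists>\<beta><\<alpha>. derives R \<beta> p))"
proof
  assume "derives R \<alpha> s"
  then obtain t where "is_proof R t" and t: "concl t = s" "depth t \<le> \<alpha>"
    by (auto simp: derives_def)
  then show "\<exists>ps. R ps s \<and> (\<forall>p\<in>ran ps. \<exists>\<beta><\<alpha>. derives R \<beta> p)"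
  proof cases
    case (1 ts s')
    have "\<exists>\<beta><\<alpha>. derives R \<beta> p" if p: "p \<in> ran (map_option concl \<circ> ts)" for p
    proof -
      obtain k u where u: "ts k = Some u" "p = concl u"
        using p by (auto simp: ran_def)
      have "depth u < \<alpha>"
        using less_le_trans[OF depth_less[of ts, OF u(1)] t(2)[unfolded 1(1)]] .
      moreover have "derives R (depth u :: 'a ordinal) p"
        using u 1(3) by (auto simp: derives_def ran_def)
      ultimately show ?thesis
        by blast
    qed
    then show ?thesis
      using 1 t by auto
  qed
next
  assume "\<exists>ps. R ps s \<and> (\<forall>p\<in>ran ps. \<exists>\<beta><\<alpha>. derives R \<beta> p)"
  then obtain ps where R: "R ps s" and ps: "\<And>p. p \<in> ran ps \<Longrightarrow> \<exists>\<beta><\<alpha>. derives R \<beta> p"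
    by blast
  have "\<forall>p\<in>ran ps. \<exists>t. is_proof R t \<and> concl t = p \<and> depth t < \<alpha>"
    using ps unfolding derives_def by (meson le_less_trans)
  then obtain T where T: "is_proof R (T p)" "concl (T p) = p" "depth (T p) < \<alpha>" if "p \<in> ran ps" for p
    by metis
  let ?t = "Node s (map_option T \<circ> ps)"
  have "map_option concl \<circ> (map_option T \<circ> ps) = ps"
    by (auto simp: fun_eq_iff option.map_comp intro!: option.map_ident_strong T(2) intro: ranI)
  then have "is_proof R ?t"
    using R T(1) by (intro is_proof.intros) (auto simp: ran_def)
  moreover have "depth ?t \<le> \<alpha>"
    using T(3) by (auto simp: ran_def intro!: Least_le)
  ultimately show "derives R \<alpha> s"
    by (auto simp: derives_def)
qed

lemma derives_mono: "derives R \<alpha> s \<Longrightarrow> \<alpha> \<le> \<beta> \<Longrightarrow> derives R \<beta> s"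
  for \<alpha> \<beta> :: "'a ordinal"
  unfolding derives_def by (auto intro: order_trans)

lemma derivesI:
  "R ps s \<Longrightarrow> (\<And>k p. ps k = Some p \<Longrightarrow> \<exists>\<beta><\<alpha>. derives R \<beta> p) \<Longrightarrow> derives R \<alpha> s"
  for \<alpha> :: "'a ordinal"
  by (subst derives_iff) (auto simp: ran_def)

lemma derivesI2:
  "R [0 \<mapsto> p, 1 \<mapsto> q] s \<Longrightarrow> \<exists>\<beta><\<alpha>. derives R \<beta> p \<Longrightarrow> \<exists>\<beta><\<alpha>. derives R \<beta> q \<Longrightarrow> derives R \<alpha> s"
  for \<alpha> :: "'a ordinal"
  by (erule derivesI) (auto split: if_splits)


section \<open>Contexts\<close>

primrec widen :: "('i, 'p) nested \<Rightarrow> ('i, 'p) ctxt \<Rightarrow> ('i, 'p) ctxt" where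
  "widen \<Theta> (Hole \<Gamma>) = Hole (\<Theta> + \<Gamma>)"
| "widen \<Theta> (InBox \<Gamma> i c) = InBox (\<Theta> + \<Gamma>) i c"

text \<open>Composition of contexts. It is needed because each nested rule is stated for a single
  context, whereas sequents arise by filling one context with another filled context.\<close>

primrec graft :: "('i, 'p) ctxt \<Rightarrow> ('i, 'p) ctxt \<Rightarrow> ('i, 'p) ctxt" where
  "graft (Hole \<Gamma>) d = widen \<Gamma> d"
| "graft (InBox \<Gamma> i c) d = InBox \<Gamma> i (graft c d)"

text \<open>Only the levels on the path from the root to the hole count, not the boxes beside it: a
  \<open>CDual A\<close> on this path can act on formulas at the hole.\<close>

primrec avail :: "('i, 'p) ctxt \<Rightarrow> ('i, 'p) fm set" where
  "avail (Hole \<Gamma>) = {A. Fm (CDual A) \<in># \<Gamma>}"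
| "avail (InBox \<Gamma> i c) = {A. Fm (CDual A) \<in># \<Gamma>} \<union> avail c"

lemma fill_widen [simp]: "fill (widen \<Theta> c) \<Delta> = \<Theta> + fill c \<Delta>"
  by (cases c) (simp_all add: add.assoc)

lemma avail_widen [simp]: "avail (widen \<Theta> c) = {A. Fm (CDual A) \<in># \<Theta>} \<union> avail c"
  by (cases c) auto

lemma fill_graft [simp]: "fill (graft c d) \<Delta> = fill c (fill d \<Delta>)"
  by (induction c) simp_all

lemma avail_graft [simp]: "avail (graft c d) = avail c \<union> avail d"
  by (induction c) auto


section \<open>Chains of single-premise rules\<close>

text \<open>Read from premise to conclusion. Cuts are excluded, so a chain can extend a derivation
  whatever its cut rank \<gamma>.\<close>

definition step :: "('i::{finite, linorder}, 'p) nested \<Rightarrow> ('i, 'p) nested \<Rightarrow> bool"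
  where "step p s \<longleftrightarrow> DC_rule [0 \<mapsto> p] s"

abbreviation steps (infix \<open>\<leadsto>\<close> 50)
  where "p \<leadsto> s \<equiv> step\<^sup>*\<^sup>* p s"

lemma step_or: "step (fill c {#Fm A, Fm B#}) (fill c {#Fm (Or A B)#})"
  and step_box: "step (fill c {#Boxed i {#Fm A#}#}) (fill c {#Fm (Box i A)#})"
  and step_dia: "step (fill c {#Fm (Dia i A), Boxed i (\<Delta> + {#Fm A#})#}) (fill c {#Fm (Dia i A), Boxed i \<Delta>#})"
  and step_CDual: "1 \<le> k \<Longrightarrow>
    step (fill c {#Fm (CDual A), Fm ((EDia ^^ k) A)#}) (fill c {#Fm (CDual A)#})"
  unfolding step_def by (rule DC_rule.intros; assumption?)+

lemma step_fill:
  assumes "step p s"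
  shows "step (fill d p) (fill d s)"
  using assms unfolding step_def
proof (cases rule: DC_rule.cases)
  case DC_ax
  then show "DC_rule [0 \<mapsto> fill d p] (fill d s)"
    by (metis fun_upd_same option.distinct(1))
next
  case (DC_and c A B)
  then show "DC_rule [0 \<mapsto> fill d p] (fill d s)"
    by (metis fun_upd_other fun_upd_same option.distinct(1) one_neq_zero)
next
  case (DC_or c A B)
  then show "DC_rule [0 \<mapsto> fill d p] (fill d s)"
    using DC_rule.DC_or[of "graft d c"] by (auto dest!: fun_cong[of _ _ 0])
next
  case (DC_box c i A)
  then show "DC_rule [0 \<mapsto> fill d p] (fill d s)"
    using DC_rule.DC_box[of "graft d c"] by (auto dest!: fun_cong[of _ _ 0])
next
  case (DC_dia c i A \<Delta>)
  then show "DC_rule [0 \<mapsto> fill d p] (fill d s)"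
    using DC_rule.DC_dia[of "graft d c"] by (auto dest!: fun_cong[of _ _ 0])
next
  case (DC_C c A)
  show "DC_rule [0 \<mapsto> fill d p] (fill d s)"
    \<comment> \<open>The premise family of the rule for \<open>C\<close> is defined at 2, unlike
      \<open>[0 \<mapsto> p]\<close>.\<close>
    using fun_cong[OF DC_C(1), of 2] by simp
next
  case (DC_CDual k c A)
  then show "DC_rule [0 \<mapsto> fill d p] (fill d s)"
    using DC_rule.DC_CDual[of k "graft d c"] by (auto dest!: fun_cong[of _ _ 0])
qed

lemma steps_fill: "p \<leadsto> s \<Longrightarrow> fill d p \<leadsto> fill d s"
  by (induction rule: rtranclp_induct) (auto intro: step_fill rtranclp.rtrancl_into_rtrancl)

text \<open>Each step may move to a larger depth that is still below \<mu>, so a chain of any finite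
  length fits.\<close>

lemma derives_steps:
  fixes \<delta> \<mu> :: "'a ordinal"
  assumes "p \<leadsto> s" "derives (DC \<gamma>) \<delta> p" "\<delta> < \<mu>"
    and limit: "\<And>x. x < \<mu> \<Longrightarrow> \<exists>y<\<mu>. x < y"
  shows "\<exists>\<beta><\<mu>. derives (DC \<gamma>) \<beta> s"
  using assms(1)
proof (induction rule: rtranclp_induct)
  case base
  then show ?case
    using assms by blast
next
  case (step q s)
  then obtain \<beta> where \<beta>: "\<beta> < \<mu>" "derives (DC \<gamma>) \<beta> q"
    by blast
  then obtain \<beta>' where "\<beta> < \<beta>'" "\<beta>' < \<mu>"
    using limit by blast
  moreover from this have "derives (DC \<gamma>) \<beta>' s"
    using step.hyps(2) \<beta> by (intro derivesI[of _ "[0 \<mapsto> q]"]) (auto simp: step_def DC_def split: if_splits)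
  ultimately show ?case
    by blast
qed

section \<open>Relaying diamonds through nested boxes\<close>

lemma foldr_Or_steps:
  "\<Theta> + {#Fm (Dia i A). i \<in># mset is#} + {#Fm B#} \<leadsto> \<Theta> + {#Fm (foldr (\<lambda>i. Or (Dia i A)) is B)#}"
proof (induction "is" arbitrary: \<Theta>)
  case (Cons i "is")
  have "\<Theta> + {#Fm (Dia i A). i \<in># mset (i # is)#} + {#Fm B#}
      \<leadsto> \<Theta> + {#Fm (Dia i A)#} + {#Fm (foldr (\<lambda>i. Or (Dia i A)) is B)#}"
    using Cons[of "\<Theta> + {#Fm (Dia i A)#}"] by (simp add: ac_simps)
  also have "step \<dots> (\<Theta> + {#Fm (foldr (\<lambda>i. Or (Dia i A)) (i # is) B)#})"
    using step_or[of "Hole \<Theta>"] by (simp add: add_mset_commute)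
  finally show ?case .
qed simp

lemma EDia_steps:
  fixes \<Theta> :: "('i::{finite, linorder}, 'p) nested"
  shows "\<Theta> + {#Fm (Dia i A). i \<in># mset agents#} \<leadsto> \<Theta> + {#Fm (EDia A)#}"
proof -
  have "(agents :: 'i list) \<noteq> []"
    by (simp add: agents_def sorted_list_of_set_eq_Nil_iff)
  then have "mset (agents :: 'i list) = mset (butlast agents) + {#last agents#}"
    by (metis append_butlast_last_id mset_append mset_single_iff_right)
  then show ?thesis
    using foldr_Or_steps[of \<Theta> A "butlast agents" "Dia (last agents) A"]
    by (simp add: EDia_def)
qed

text \<open>The context \<open>c'\<close> is \<open>c\<close> enriched, at each level, with the diamond formulas that relay \<open>A\<close>.\<close>

lemma EDia_to_root:
  fixes c :: "('i::{finite, linorder}, 'p) ctxt"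
  assumes "1 \<le> k"
  shows "\<exists>c' m. 1 \<le> m \<and> avail c \<subseteq> avail c' \<and>
    (\<forall>\<Lambda>. fill c' (\<Lambda> + {#Fm ((EDia ^^ k) A)#}) \<leadsto> fill c \<Lambda> + {#Fm ((EDia ^^ m) A)#})"
proof (induction c)
  case (Hole \<Gamma>)
  show ?case
    using assms by (intro exI[of _ "Hole \<Gamma>"] exI[of _ k]) (simp add: add.assoc)
next
  case (InBox \<Gamma> i c)
  then obtain c' m where m: "1 \<le> m" and av: "avail c \<subseteq> avail c'"
    and st: "\<And>\<Lambda>. fill c' (\<Lambda> + {#Fm ((EDia ^^ k) A)#}) \<leadsto> fill c \<Lambda> + {#Fm ((EDia ^^ m) A)#}"
    by blast
  let ?A = "(EDia ^^ m) A"
  let ?D = "{#Fm (Dia i ?A). i \<in># mset agents#}"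
  have i: "i \<in># mset agents"
    by (simp add: agents_def)
  define D where "D = ?D - {#Fm (Dia i ?A)#}"
  have D: "?D = D + {#Fm (Dia i ?A)#}"
    using i unfolding D_def by (simp del: set_mset_mset)
  \<comment> \<open>Inside the box the induction hypothesis yields \<open>?A\<close>. It is absorbed
    by \<open>Dia i ?A\<close> outside, and then the diamonds of all agents merge into
    \<open>EDia ?A\<close>; so each box crossed adds one to the exponent.\<close>
  have "fill (InBox (\<Gamma> + ?D) i c') (\<Lambda> + {#Fm ((EDia ^^ k) A)#}) \<leadsto>
      fill (InBox \<Gamma> i c) \<Lambda> + {#Fm ((EDia ^^ Suc m) A)#}" for \<Lambda>
  proof -
    have "fill (InBox (\<Gamma> + ?D) i c') (\<Lambda> + {#Fm ((EDia ^^ k) A)#}) \<leadsto>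
      fill (InBox (\<Gamma> + ?D) i (Hole {#})) (fill c \<Lambda> + {#Fm ?A#})"
      using steps_fill[OF st, of "InBox (\<Gamma> + ?D) i (Hole {#})"] by simp
    also have "step \<dots> (\<Gamma> + {#Boxed i (fill c \<Lambda>)#} + ?D)"
      using step_dia[of "Hole (\<Gamma> + D)"] unfolding D by (simp add: ac_simps add_mset_commute)
    also have "\<Gamma> + {#Boxed i (fill c \<Lambda>)#} + ?D \<leadsto>
        \<Gamma> + {#Boxed i (fill c \<Lambda>)#} + {#Fm (EDia ?A)#}"
      by (rule EDia_steps)
    finally show ?thesis
      by simp
  qed
  then show ?case
    using av by (intro exI[of _ "InBox (\<Gamma> + ?D) i c'"] exI[of _ "Suc m"]) auto
qed

text \<open>If \<open>CDual A\<close> is at the level of the hole, one rule application with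
  exponent 1 absorbs \<open>EDia A\<close>. Otherwise \<open>EDia A\<close> is first relayed up to
  the level of some \<open>CDual A\<close>, where its iterate is absorbed. The inclusion of
  \<open>avail\<close> keeps other virtual formulas justified in \<open>c'\<close>.\<close>

lemma avail_steps:
  assumes "A \<in> avail c"
  shows "\<exists>c'. avail c \<subseteq> avail c' \<and> (\<forall>\<Lambda>. fill c' (\<Lambda> + {#Fm (EDia A)#}) \<leadsto> fill c \<Lambda>)"
  using assms
proof (induction c)
  case (Hole \<Gamma>)
  then obtain \<Gamma>' where \<Gamma>: "\<Gamma> = \<Gamma>' + {#Fm (CDual A)#}"
    by (auto dest: multi_member_split)
  have "step (fill (Hole \<Gamma>) (\<Lambda> + {#Fm (EDia A)#})) (fill (Hole \<Gamma>) \<Lambda>)" for \<Lambda>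
    using step_CDual[of 1 "Hole (\<Gamma>' + \<Lambda>)" A] by (simp add: \<Gamma> ac_simps)
  then show ?case
    by blast
next
  case (InBox \<Gamma> i c)
  show ?case
  proof (cases "A \<in> avail c")
    case True
    then obtain c' where c': "avail c \<subseteq> avail c'"
      and st: "\<And>\<Lambda>. fill c' (\<Lambda> + {#Fm (EDia A)#}) \<leadsto> fill c \<Lambda>"
      using InBox.IH by blast
    show ?thesis
      using c' steps_fill[OF st, of "InBox \<Gamma> i (Hole {#})"]
      by (intro exI[of _ "InBox \<Gamma> i c'"]) auto
  next
    case False
    then obtain \<Gamma>' where \<Gamma>: "\<Gamma> = \<Gamma>' + {#Fm (CDual A)#}"
      using InBox.prems by (auto dest: multi_member_split)
    obtain c' m where m: "1 \<le> m" and av: "avail (InBox \<Gamma> i c) \<subseteq> avail c'"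
      and st: "\<And>\<Lambda>. fill c' (\<Lambda> + {#Fm (EDia A)#}) \<leadsto> fill (InBox \<Gamma> i c) \<Lambda> + {#Fm ((EDia ^^ m) A)#}"
      using EDia_to_root[of 1 "InBox \<Gamma> i c" A] by auto
    have "step (fill (InBox \<Gamma> i c) \<Lambda> + {#Fm ((EDia ^^ m) A)#}) (fill (InBox \<Gamma> i c) \<Lambda>)" for \<Lambda>
      using step_CDual[OF m, of "Hole (\<Gamma>' + {#Boxed i (fill c \<Lambda>)#})" A]
      by (simp add: \<Gamma> ac_simps add_mset_commute)
    then show ?thesis
      using av st rtranclp.rtrancl_into_rtrancl by metis
  qed
qed

lemma nested_of_simps [simp]:
  "nested_of {#} = {#}"
  "nested_of (add_mset A \<Gamma>) = add_mset (Fm A) (nested_of \<Gamma>)"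
  "nested_of (\<Gamma> + \<Delta>) = nested_of \<Gamma> + nested_of \<Delta>"
  by (simp_all add: nested_of_def)

text \<open>Each element of \<Gamma> takes one diamond step. Since \<open>Dia i G\<close> survives
  the step, repeated elements can share one occurrence, and mere membership in \<Theta>
  suffices.\<close>

lemma Dia_steps:
  assumes "\<And>G. G \<in># \<Gamma> \<Longrightarrow> Fm (Dia i G) \<in># \<Theta>"
  shows "\<Theta> + {#Boxed i (nested_of \<Gamma> + \<Lambda>)#} \<leadsto> \<Theta> + {#Boxed i \<Lambda>#}"
  using assms
proof (induction \<Gamma> arbitrary: \<Lambda>)
  case empty
  then show ?case by simp
next
  case (add G \<Gamma>)
  then have "Fm (Dia i G) \<in># \<Theta>"
    by simp
  then obtain \<Theta>' where \<Theta>: "\<Theta> = \<Theta>' + {#Fm (Dia i G)#}"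
    by (auto dest: multi_member_split)
  have "\<Theta> + {#Boxed i (nested_of (add_mset G \<Gamma>) + \<Lambda>)#} \<leadsto> \<Theta> + {#Boxed i (\<Lambda> + {#Fm G#})#}"
    using add.IH[of "\<Lambda> + {#Fm G#}"] add.prems by simp
  also have "step \<dots> (\<Theta> + {#Boxed i \<Lambda>#})"
    using step_dia[of "Hole \<Theta>'"] by (simp add: \<Theta> ac_simps add_mset_commute)
  finally show ?case .
qed


section \<open>The embedding\<close>

lemma DC_ruleI: "DC_rule ps s \<Longrightarrow> DC \<gamma> ps s"
  and DC_cutI: "DC_cut \<gamma> ps s \<Longrightarrow> DC \<gamma> ps s"
  by (simp_all add: DC_def)

lemma split_principal:
  assumes "\<Gamma> + {#F#} = R + V" "F \<notin># V"
  obtains R' where "R = R' + {#F#}" "\<Gamma> = R' + V"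
proof -
  have "F \<in># R"
    using assms by (metis add_mset_add_single union_iff union_single_eq_member)
  then obtain R' where "R = R' + {#F#}"
    by (auto dest: multi_member_split)
  then show thesis
    using assms(1) that by (simp add: add_mset_commute)
qed

lemma split_union:
  fixes \<Gamma> \<Delta> R V :: "'b multiset"
  assumes "\<Gamma> + \<Delta> = R + V"
  obtains R1 R2 V1 V2 where "R = R1 + R2" "V = V1 + V2" "\<Gamma> = R1 + V1" "\<Delta> = R2 + V2"
proof (rule that)
  have *: "count \<Gamma> x + count \<Delta> x = count R x + count V x" for x
    using assms by (metis count_union)
  \<comment> \<open>As much of \<open>V\<close> as possible is taken from \<Gamma>:
    \<open>V1\<close> is their intersection and \<open>R1\<close> the rest of \<Gamma>.\<close>
  show "R = (\<Gamma> - V) + (R - (\<Gamma> - V))"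
    using * by (intro multiset_eqI) (metis (no_types) count_union count_diff le_add_diff_inverse le_diff_conv le_add1)
  show "V = (\<Gamma> - (\<Gamma> - V)) + (V - \<Gamma>)" "\<Gamma> = (\<Gamma> - V) + (\<Gamma> - (\<Gamma> - V))"
    by (intro multiset_eqI; simp)+
  show "\<Delta> = (R - (\<Gamma> - V)) + (V - \<Gamma>)"
  proof (rule multiset_eqI)
    show "count \<Delta> x = count ((R - (\<Gamma> - V)) + (V - \<Gamma>)) x" for x
      using *[of x] by simp
  qed
qed

text \<open>The sequent is split into a real part \<open>R\<close> and a virtual part \<open>V\<close>, whose elements \<open>CDual A\<close> are
  not at the hole but above it. Generalising over all contexts makes weakening and
  necessitation superfluous, and virtual formulas survive the passage into the box in the
  rule for \<open>\<box>\<^sub>i\<close>.\<close>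

lemma derives_GC_imp_DC:
  fixes \<Gamma> R V :: "('i::{finite, linorder}, 'p) shallow" and \<alpha> \<gamma> :: "'a ordinal"
  assumes "derives (GC \<gamma>) \<alpha> (R + V)" "\<And>F. F \<in># V \<Longrightarrow> F \<in> CDual ` avail c"
  shows "derives (DC \<gamma>) (\<omega> * \<alpha>) (fill c (nested_of R))"
  using assms
proof (induction \<alpha> arbitrary: c R V rule: less_induct)
  case (less \<alpha>)
  obtain ps where ps: "GC \<gamma> ps (R + V)" and prem: "\<And>k p. ps k = Some p \<Longrightarrow> \<exists>\<beta><\<alpha>. derives (GC \<gamma>) \<beta> p"
    using less.prems(1) by (subst (asm) derives_iff) (auto simp: ran_def)
  \<comment> \<open>Only formulas of the form \<open>CDual A\<close> are virtual, so every other
    principal formula is real.\<close>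
  have V: "F \<notin># V" if "\<And>A. F \<noteq> CDual A" for F
    using less.prems(2) that by blast
  have IH: "\<exists>\<beta><\<omega> * \<alpha>. derives (DC \<gamma>) \<beta> (fill c' (nested_of R'))"
    if "ps k = Some (R' + V')" "\<And>F. F \<in># V' \<Longrightarrow> F \<in> CDual ` avail c'" for k c' R' V'
    using prem[OF that(1)] less.IH that(2) omega_times_less_mono by blast
  have chain: "derives (DC \<gamma>) (\<omega> * \<alpha>) s"
    if st: "p \<leadsto> s" and p: "\<exists>\<beta><\<omega> * \<alpha>. derives (DC \<gamma>) \<beta> p" for p s
    using derives_steps[OF st _ _ omega_times_limit] p derives_mono less_imp_le by meson
  consider "GC_rule ps (R + V)" | "GC_cut \<gamma> ps (R + V)"
    using ps by (auto simp: GC_def)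
  then show ?case
  proof cases
    case 1
    then show ?thesis
    proof cases
      case (GC_ax \<Gamma> p)
      have "Pos p \<in># R" "Neg p \<in># R"
        using GC_ax(2) V[of "Pos p"] V[of "Neg p"]
        by (metis fm.distinct union_iff union_single_eq_member add_mset_add_single multi_member_last)+
      then obtain R' where R: "R = R' + {#Pos p, Neg p#}"
        by (metis (no_types, lifting) add_mset_add_single fm.distinct(1) insert_noteq_member
            multi_member_split union_mset_add_mset_right)
      show ?thesis
        using DC_rule.DC_ax[of "graft c (Hole (nested_of R'))" p]
        by (intro derivesI[of _ Map.empty]) (auto simp: DC_def R add.assoc nested_of_def)
    next
      case (GC_and \<Gamma> A B)
      obtain R' where R: "R = R' + {#And A B#}" "\<Gamma> = R' + V"
        using split_principal[OF GC_and(2)[symmetric]] V by blast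
      let ?c = "graft c (Hole (nested_of R'))"
      have "\<exists>\<beta><\<omega> * \<alpha>. derives (DC \<gamma>) \<beta> (fill ?c {#Fm A#})"
        "\<exists>\<beta><\<omega> * \<alpha>. derives (DC \<gamma>) \<beta> (fill ?c {#Fm B#})"
        using IH[of 0 "R' + {#A#}" V c] IH[of 1 "R' + {#B#}" V c] less.prems(2)
        by (auto simp: GC_and(1) R(2) ac_simps)
      then have "derives (DC \<gamma>) (\<omega> * \<alpha>) (fill ?c {#Fm (And A B)#})"
        by (rule derivesI2[where R = "DC \<gamma>", OF DC_ruleI[OF DC_and]])
      then show ?thesis
        by (simp add: R(1))
    next
      case (GC_or \<Gamma> A B)
      obtain R' where R: "R = R' + {#Or A B#}" "\<Gamma> = R' + V"
        using split_principal[OF GC_or(2)[symmetric]] V by blast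
      let ?c = "graft c (Hole (nested_of R'))"
      have "\<exists>\<beta><\<omega> * \<alpha>. derives (DC \<gamma>) \<beta> (fill ?c {#Fm A, Fm B#})"
        using IH[of 0 "R' + {#A, B#}" V c] less.prems(2)
        by (auto simp: GC_or(1) R(2) ac_simps nested_of_def)
      then show ?thesis
        using chain[OF r_into_rtranclp[of step, OF step_or[of ?c A B]]] by (simp add: R(1))
    next
      case (GC_box \<Gamma> \<Delta> A i \<Sigma>)
      \<comment> \<open>The conclusion without its principal formula. It includes \<Sigma>, since
        weakening is absorbed by the context.\<close>
      define G where "G = image_mset (Dia i) \<Gamma> + image_mset CDual \<Delta> + \<Sigma>"
      have "G + {#Box i A#} = R + V"
        using GC_box(2) by (simp add: G_def ac_simps)
      then obtain R' where R: "R = R' + {#Box i A#}" "G = R' + V"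
        using V by (rule split_principal) auto
      \<comment> \<open>The hole of the new box starts empty and all of \<open>R'\<close> stays
        outside. Hence each \<open>CDual D\<close> with \<open>D\<close> in \<Delta>, whether real
        or virtual before, is virtual inside the box.\<close>
      let ?d = "InBox (nested_of R') i (Hole {#})"
      have "CDual D \<in> CDual ` avail (graft c ?d)" if "D \<in># \<Delta>" for D
      proof -
        have "CDual D \<in># R' + V"
          using that unfolding R(2)[symmetric] G_def by auto
        then show ?thesis
          using less.prems(2)[of "CDual D"] by (auto simp: nested_of_def)
      qed
      then have "\<exists>\<beta><\<omega> * \<alpha>. derives (DC \<gamma>) \<beta> (fill (graft c ?d) (nested_of (\<Gamma> + {#A#})))"
        by (intro IH[of 0 _ "image_mset CDual \<Delta>"]) (auto simp: GC_box(1) ac_simps)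
      moreover have "fill (graft c ?d) (nested_of (\<Gamma> + {#A#})) \<leadsto> fill c (nested_of R)"
      proof -
        have "Dia i B \<in># R'" if "B \<in># \<Gamma>" for B
        proof -
          have "Dia i B \<in># R' + V"
            using that unfolding R(2)[symmetric] G_def by auto
          then show ?thesis
            using V[of "Dia i B"] by auto
        qed
        then have "nested_of R' + {#Boxed i (nested_of \<Gamma> + {#Fm A#})#} \<leadsto> nested_of R' + {#Boxed i {#Fm A#}#}"
          by (intro Dia_steps) (auto simp: nested_of_def)
        also have "step \<dots> (nested_of R' + {#Fm (Box i A)#})"
          using step_box[of "Hole (nested_of R')"] by simp
        finally show ?thesis
          by (auto simp: R(1) dest: steps_fill[of _ _ c])
      qed
      ultimately show ?thesis
        using chain by blast
    next
      case (GC_C \<Gamma> A)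
      obtain R' where R: "R = R' + {#C A#}" "\<Gamma> = R' + V"
        using split_principal[OF GC_C(2)[symmetric]] V by blast
      let ?c = "graft c (Hole (nested_of R'))"
      have "\<exists>\<beta><\<omega> * \<alpha>. derives (DC \<gamma>) \<beta> (fill ?c {#Fm ((EBox ^^ k) A)#})" if "1 \<le> k" for k
        using IH[of k "R' + {#(EBox ^^ k) A#}" V c] less.prems(2) that
        by (auto simp: GC_C(1) R(2) ac_simps)
      then have "derives (DC \<gamma>) (\<omega> * \<alpha>) (fill ?c {#Fm (C A)#})"
        by (intro derivesI[where R = "DC \<gamma>", OF DC_ruleI[OF DC_C]]) (auto split: if_splits)
      then show ?thesis
        by (simp add: R(1))
    next
      case (GC_CDual \<Gamma> A)
      \<comment> \<open>The principal formula may be assumed virtual: if it is real, it is moved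
        from \<open>R\<close> into the context, which leaves the filled sequent unchanged.\<close>
      have "\<exists>c\<^sub>1 R\<^sub>1 V\<^sub>1. \<Gamma> + {#CDual A#} = R\<^sub>1 + V\<^sub>1 \<and> fill c\<^sub>1 (nested_of R\<^sub>1) = fill c (nested_of R) \<and>
        CDual A \<in># V\<^sub>1 \<and> (\<forall>F. F \<in># V\<^sub>1 \<longrightarrow> F \<in> CDual ` avail c\<^sub>1)"
      proof (cases "CDual A \<in># V")
        case True
        then show ?thesis
          using GC_CDual(2) less.prems(2) by metis
      next
        case False
        then obtain R' where R: "R = R' + {#CDual A#}" "\<Gamma> = R' + V"
          using split_principal[OF GC_CDual(2)[symmetric]] by blast
        show ?thesis
          using less.prems(2) R
          by (intro exI[of _ "graft c (Hole {#Fm (CDual A)#})"] exI[of _ R'] exI[of _ "V + {#CDual A#}"]) auto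
      qed
      then obtain c\<^sub>1 R\<^sub>1 V\<^sub>1 where 1: "\<Gamma> + {#CDual A#} = R\<^sub>1 + V\<^sub>1"
        "fill c\<^sub>1 (nested_of R\<^sub>1) = fill c (nested_of R)"
        "CDual A \<in># V\<^sub>1" "\<And>F. F \<in># V\<^sub>1 \<Longrightarrow> F \<in> CDual ` avail c\<^sub>1"
        by blast
      have "A \<in> avail c\<^sub>1"
        using 1(3,4) by blast
      then obtain c' where c': "avail c\<^sub>1 \<subseteq> avail c'"
        "fill c' (nested_of R\<^sub>1 + {#Fm (EDia A)#}) \<leadsto> fill c (nested_of R)"
        using avail_steps[of A c\<^sub>1] 1(2) by metis
      have "\<exists>\<beta><\<omega> * \<alpha>. derives (DC \<gamma>) \<beta> (fill c' (nested_of (R\<^sub>1 + {#EDia A#})))"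
      proof (rule IH[of 0 _ V\<^sub>1])
        have "\<Gamma> + {#CDual A, EDia A#} = R\<^sub>1 + {#EDia A#} + V\<^sub>1"
          using 1(1) by (simp add: add_mset_commute)
        then show "ps 0 = Some (R\<^sub>1 + {#EDia A#} + V\<^sub>1)"
          by (simp add: GC_CDual(1))
      qed (use 1(4) c'(1) in blast)
      then show ?thesis
        using chain[OF c'(2)] by simp
    qed
  next
    case 2
    then show ?thesis
    proof cases
      case (1 A \<Gamma> \<Delta>)
      \<comment> \<open>The shallow cut splits its side formulas between the premises, the nested
        cut shares them. So each premise is derived in a context that already holds the real
        formulas of the other one.\<close>
      obtain R1 R2 V1 V2 where R: "R = R1 + R2" "V = V1 + V2" "\<Gamma> = R1 + V1" "\<Delta> = R2 + V2"
        using split_union[OF 1(2)[symmetric]] .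
      let ?c = "graft c (Hole (nested_of R))"
      have "\<exists>\<beta><\<omega> * \<alpha>. derives (DC \<gamma>) \<beta> (fill ?c {#Fm A#})"
        using IH[of 0 "R1 + {#A#}" V1 "graft c (Hole (nested_of R2))"] less.prems(2)
        by (auto simp: 1(1) R ac_simps)
      moreover have "\<exists>\<beta><\<omega> * \<alpha>. derives (DC \<gamma>) \<beta> (fill ?c {#Fm (neg A)#})"
        using IH[of 1 "R2 + {#neg A#}" V2 "graft c (Hole (nested_of R1))"] less.prems(2)
        by (auto simp: 1(1) R ac_simps)
      ultimately have "derives (DC \<gamma>) (\<omega> * \<alpha>) (fill ?c {#})"
        by (rule derivesI2[where R = "DC \<gamma>", OF DC_cutI[OF DC_cut.intros[OF 1(3)]]])
      then show ?thesis
        by simp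
    qed
  qed
qed

theorem theorem3p12:
  fixes \<Gamma> :: "('i::{finite, linorder}, 'p) shallow" and \<alpha> \<gamma> :: "'a ordinal"
  assumes "derives (GC \<gamma>) \<alpha> \<Gamma>"
  shows "derives (DC \<gamma>) (\<omega> * \<alpha>) (nested_of \<Gamma>)"
  using derives_GC_imp_DC[of \<gamma> \<alpha> \<Gamma> "{#}" "Hole {#}"] assms by simp

end
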